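(* Let $\mathbf{A}\in\mathbb{R}^{m\times n}$ be a full-column-rank matrix with no zero rows, let $p>2$ and $\gamma:=1-\frac{2}{p}$, let $\overline{\mathbf{w}}\in\mathbb{R}^m_{>0}$ be the (row-wise) $\ell_p$-Lewis weights of $\mathbf{A}$, and $\overline{\mathbf{W}}:=\operatorname{Diag}(\overline{\mathbf{w}})$. Let $\mathcal{T}(\mathbf{w}):=\sigma(\mathbf{W}^{\gamma/2}\mathbf{A})$ for $\mathbf{w}\in\mathbb{R}^m_{>0}$, where $\mathbf{W}:=\operatorname{Diag}(\mathbf{w})$ and $\sigma(\cdot)$ is the vector of leverage scores. Define $$\mathbf{P}:=\overline{\mathbf{W}}^{\gamma/2}\mathbf{A}\left(\mathbf{A}^\top\overline{\mathbf{W}}^{\gamma}\mathbf{A}\right)^{-1}\mathbf{A}^\top\overline{\mathbf{W}}^{\gamma/2}\in\mathbb{R}^{m\times m},\qquad \mathbf{K}:=\overline{\mathbf{W}}^{-1}(\mathbf{P}\circ\mathbf{P})\in\mathbb{R}^{m\times m},$$ where $\circ$ is the entrywise (Hadamard) product, and define the Jacobian $$\mathbf{J}:=\left[\frac{\partial}{\partial x_j}\log\mathcal{T}_i(e^{\mathbf{x}})\right]_{i,j\in[m]}\Bigg|_{\mathbf{x}=\log\overline{\mathbf{w}}}.$$ Then $\mathbf{J}=\gamma(\mathbf{I}-\mathbf{K})$. Moreover, all eigenvalues of $\mathbf{K}$ lie in $[0,1]$. Therefore, the spectral radius of $\mathbf{J}$ is $$\left(1-\frac{2}{p}\right)\lef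t(1-\lambda_{\min}(\mathbf{K})\right).$$
   Context: Exponentials and logarithms of vectors are coordinatewise. For a full-column-rank matrix $\mathbf{B}$ with rows $\mathbf{b}_i^\top$, the $i$-th leverage score is $\sigma_i(\mathbf{B}):=\mathbf{b}_i^\top(\mathbf{B}^\top\mathbf{B})^{-1}\mathbf{b}_i$, and $\sigma(\mathbf{B})$ is the vector of all leverage scores. The $\ell_p$-Lewis weights of $\mathbf{A}$ are the unique vector $\overline{\mathbf{w}}\in\mathbb{R}^m_{>0}$ satisfying $\overline{w}_i=\sigma_i(\overline{\mathbf{W}}^{1/2-1/p}\mathbf{A})$ for all $i\in[m]$, i.e. $\overline{\mathbf{w}}=\mathcal{T}(\overline{\mathbf{w}})$ (existence and uniqueness are known). $\lambda_{\min}(\mathbf{K})$ denotes the smallest eigenvalue of $\mathbf{K}$. *)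

theory Defs
  imports "HOL-Analysis.Analysis"
begin

definition vec_exp :: "real^'m \<Rightarrow> real^'m" where
  "vec_exp x = (\<chi> i. exp (x $ i))"

definition vec_ln :: "real^'m \<Rightarrow> real^'m" where
  "vec_ln x = (\<chi> i. ln (x $ i))"

definition Diag :: "real^'m \<Rightarrow> real^'m^'m" where
  "Diag w = (\<chi> i j. if i = j then w $ i else 0)"

(* The real power Diag(w)^a of a diagonal matrix; only meaningful for entrywise positive w. *)
definition Diag_powr :: "real^'m \<Rightarrow> real \<Rightarrow> real^'m^'m" where
  "Diag_powr w a = Diag (\<chi> i. (w $ i) powr a)"

definition hadamard :: "real^'n^'m \<Rightarrow> real^'n^'m \<Rightarrow> real^'n^'m" where
  "hadamard A B = (\<chi> i j. A $ i $ j * B $ i $ j)"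

(* Intended for B of full column rank, so that the Gram matrix is invertible. *)
definition leverage_scores :: "real^'n^'m \<Rightarrow> real^'m" where
  "leverage_scores B = (\<chi> i. row i B \<bullet> (matrix_inv (transpose B ** B) *v row i B))"

(* For A of full column rank without zero rows there is exactly one such w. *)
definition is_lewis_weights :: "real \<Rightarrow> real^'n^'m \<Rightarrow> real^'m \<Rightarrow> bool" where
  "is_lewis_weights p A w \<longleftrightarrow>
     (\<forall>i. w $ i > 0) \<and>
     (\<forall>i. w $ i = leverage_scores (Diag_powr w (1/2 - 1/p) ** A) $ i)"

(* All complex eigenvalues of a real square matrix. *)
definition eigenvalues :: "real^'m^'m \<Rightarrow> complex set" where
  "eigenvalues M =
     {c. \<exists>v :: complex^'m. v \<noteq> 0 \<and> (\<chi> i j. complex_of_real (M $ i $ j)) *v v = c *s v}"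

definition spectral_radius :: "real^'m^'m \<Rightarrow> real" where
  "spectral_radius M = Max (cmod ` eigenvalues M)"

(* The smallest real eigenvalue; intended for matrices all of whose eigenvalues are real. *)
definition lambda_min :: "real^'m^'m \<Rightarrow> real" where
  "lambda_min M = Min {x. complex_of_real x \<in> eigenvalues M}"

end

theory Submission
  imports Defs
begin

text \<open>Differentiating \<open>M y = a\<close> for \<open>M = A\<^sup>T Diag(e\<^bsup>\<gamma>x\<^esup>) A\<close> gives
  the partial derivative of the \<open>i\<close>-th leverage score in direction \<open>h\<close> as
  \<open>\<gamma> (w\<^sub>i h\<^sub>i - (\<Sum>j. P\<^sub>i\<^sub>j\<^sup>2 h\<^sub>j))\<close> at a fixed point of \<open>T\<close>.  For the eigenvalues,
  \<open>K\<close> is self-adjoint for the inner product weighted by \<open>w\<close>, with quadratic form \<open>P \<circ> P\<close>.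
  As \<open>P\<close> is an orthogonal projection with diagonal \<open>w\<close>, its Hadamard square is positive
  semidefinite and has row sums \<open>w\<close>, which bounds the form between \<open>0\<close> and \<open>Diag w\<close>.\<close>

section \<open>The derivative of the inverse of a matrix\<close>

lemma has_derivative_vec_lambda:
  fixes f :: "'i::finite \<Rightarrow> 'a::real_normed_vector \<Rightarrow> real"
  assumes "\<And>i. (f i has_derivative f' i) (at x)"
  shows "((\<lambda>x. \<chi> i. f i x) has_derivative (\<lambda>h. \<chi> i. f' i h)) (at x)"
  using assms
  by (subst has_derivative_componentwise_within) (auto simp: Basis_vec_def inner_axis)

lemma bounded_bilinear_matrix_vector_mult:
  "bounded_bilinear (\<lambda>(A::real^'n^'m) x. A *v x)"
  unfolding bilinear_conv_bounded_bilinear[symmetric] bilinear_def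
  by (auto simp: linear_iff matrix_vector_mult_def vec_eq_iff algebra_simps sum.distrib
      sum_distrib_left)

text \<open>The Leibniz expansion is a polynomial in the entries. The hypothesis is entrywise so
  that it also fits the numerators of Cramer's rule, where one column is constant.\<close>

lemma differentiable_det:
  fixes M :: "'a::real_normed_vector \<Rightarrow> real^'n^'n"
  assumes "\<And>i j. (\<lambda>y. M y $ i $ j) differentiable (at x)"
  shows "(\<lambda>y. det (M y)) differentiable (at x)"
proof -
  have "\<forall>i j. \<exists>D. ((\<lambda>y. M y $ i $ j) has_derivative D) (at x)"
    using assms by (simp add: differentiable_def)
  then obtain D where D: "\<And>i j. ((\<lambda>y. M y $ i $ j) has_derivative D i j) (at x)"
    by metis
  have "(\<lambda>y. \<Prod>i\<in>UNIV. M y $ i $ p i) differentiable (at x)" for p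
    unfolding differentiable_def by (rule exI, rule has_derivative_prod, rule D)
  then show ?thesis
    unfolding det_def by (intro differentiable_sum differentiable_mult) auto
qed

lemma
  fixes M :: "real^'n^'n"
  assumes "invertible M"
  shows matrix_inv_right: "M ** matrix_inv M = mat 1"
    and matrix_inv_left: "matrix_inv M ** M = mat 1"
  using someI_ex[OF assms[unfolded invertible_def]] by (simp_all add: matrix_inv_def)

lemma matrix_inv_mult_eq:
  fixes M :: "real^'n^'n"
  assumes "invertible M" "M *v y = b"
  shows "matrix_inv M *v b = y"
  using assms by (metis matrix_inv_left matrix_vector_mul_assoc matrix_vector_mul_lid)

text \<open>Cramer's rule shows that the solution depends differentiably on the matrix; the derivative
  then results from differentiating the equation.\<close>

lemma has_derivative_matrix_inv_mult:
  fixes M :: "'a::real_normed_vector \<Rightarrow> real^'n^'n"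
  assumes M: "(M has_derivative M') (at x)" and inv: "invertible (M x)"
  shows "((\<lambda>z. matrix_inv (M z) *v b) has_derivative
    (\<lambda>h. - (matrix_inv (M x) *v (M' h *v (matrix_inv (M x) *v b))))) (at x)"
proof -
  define y where "y = (\<lambda>z. (\<chi> k. det (\<chi> i j. if j = k then b$i else M z$i$j) / det (M z)))"
  have ent: "(\<lambda>z. M z $ i $ j) differentiable (at x)" for i j
    unfolding differentiable_def
    by (rule exI, rule bounded_linear.has_derivative[OF bounded_linear_vec_nth],
        rule bounded_linear.has_derivative[OF bounded_linear_vec_nth M])
  have ent': "(\<lambda>z. (\<chi> i j. if j = k then b$i else M z$i$j) $ i $ j) differentiable (at x)" for i j k
    using ent[of i j] by (cases "j = k") auto
  have det0: "det (M x) \<noteq> 0"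
    using inv by (simp add: invertible_det_nz)
  \<comment> \<open>Invertibility persists near \<open>x\<close>, so the linear system can be solved
    on a whole neighbourhood, as differentiating it requires.\<close>
  have "isCont (\<lambda>z. det (M z)) x"
    by (rule differentiable_imp_continuous_within[OF differentiable_det[OF ent]])
  then have ev: "eventually (\<lambda>z. det (M z) \<noteq> 0) (nhds x)"
    unfolding isCont_def tendsto_at_iff_tendsto_nhds[of "\<lambda>z. det (M z)"]
    using det0 by (rule tendsto_imp_eventually_ne)
  have sol: "eventually (\<lambda>z. M z *v y z = b \<and> matrix_inv (M z) *v b = y z) (nhds x)"
    using ev
  proof eventually_elim
    case (elim z)
    then have "M z *v y z = b"
      using cramer[of "M z" "y z" b] by (simp add: y_def)
    with elim show ?case
      using matrix_inv_mult_eq invertible_det_nz by blast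
  qed
  have "\<exists>D. ((\<lambda>z. y z $ k) has_derivative D) (at x)" for k
    unfolding y_def differentiable_def[symmetric] vec_lambda_beta
    by (intro differentiable_divide differentiable_det ent ent' det0)
  then obtain D where D: "\<And>k. ((\<lambda>z. y z $ k) has_derivative D k) (at x)"
    by metis
  define y' where "y' = (\<lambda>h. \<chi> k. D k h)"
  have y: "(y has_derivative y') (at x)"
    using has_derivative_vec_lambda[of "\<lambda>k z. y z $ k" D x] D by (simp add: y'_def)
  \<comment> \<open>So far \<open>y'\<close> is only known to exist. Comparing the product rule with
    the constant right-hand side determines it without differentiating any determinant
    explicitly.\<close>
  have "((\<lambda>z. M z *v y z) has_derivative (\<lambda>h. M x *v y' h + M' h *v y x)) (at x)"
    by (rule bounded_bilinear.FDERIV[OF bounded_bilinear_matrix_vector_mult M y])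
  moreover have "((\<lambda>z. M z *v y z) has_derivative (\<lambda>h. 0)) (at x)"
    by (rule has_derivative_transform_eventually[of "\<lambda>z. b"])
      (use sol in \<open>auto simp: eventually_nhds_conv_at elim: eventually_mono\<close>)
  ultimately have "(\<lambda>h. M x *v y' h + M' h *v y x) = (\<lambda>h. 0)"
    by (rule has_derivative_unique)
  then have "M x *v (- y' h) = M' h *v y x" for h
    by (simp add: fun_eq_iff linear_neg[OF matrix_vector_mul_linear] minus_unique)
  then have eq: "y' h = - (matrix_inv (M x) *v (M' h *v y x))" for h
    using matrix_inv_mult_eq[OF inv] by (metis minus_minus)
  have yx: "matrix_inv (M x) *v b = y x"
    using sol eventually_nhds_x_imp_x by fastforce
  show ?thesis
    unfolding yx eq[symmetric]
    by (rule has_derivative_transform_eventually[OF y])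
      (use sol yx in \<open>auto simp: eventually_nhds_conv_at elim: eventually_mono\<close>)
qed

section \<open>Weighted Gram matrices\<close>

lemma symmetric_nth:
  assumes "transpose M = M"
  shows "M $ j $ i = M $ i $ j"
  using arg_cong[OF assms, of "\<lambda>Q. Q $ i $ j"] by (simp add: transpose_def)

lemma Diag_mult_nth: "(Diag d ** A) $ i $ j = d $ i * A $ i $ j"
  by (simp add: matrix_matrix_mult_def Diag_def if_distrib if_distribR cong: if_cong)

lemma row_Diag_mult: "row i (Diag d ** A) = d $ i *\<^sub>R row i A"
  by (simp add: vec_eq_iff row_def Diag_mult_nth)

lemma gram_nth:
  "(transpose A ** Diag d ** A) $ k $ l = (\<Sum>i\<in>UNIV. d $ i * A $ i $ k * A $ i $ l)"
  by (simp add: matrix_matrix_mult_def Diag_def transpose_def if_distrib mult_ac cong: if_cong)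

text \<open>Merges the two half powers occurring in a leverage score into one diagonal
  weight.\<close>

lemma gram_Diag_mult:
  fixes A :: "real^'n^'m"
  shows "transpose (Diag d ** A) ** (Diag d ** A) = transpose A ** Diag (\<chi> i. d $ i * d $ i) ** A"
proof -
  have "(transpose B ** C) $ k $ l = (\<Sum>i\<in>UNIV. B $ i $ k * C $ i $ l)"
    for B C :: "real^'n^'m" and k l
    by (simp add: matrix_matrix_mult_def transpose_def)
  then show ?thesis
    by (simp add: vec_eq_iff gram_nth Diag_mult_nth mult_ac)
qed

text \<open>Moving \<open>A\<close> across the inner product diagonalizes the form. The case
  \<open>x = y\<close> gives definiteness; the derivative of the leverage scores also reads off its
  squares from here.\<close>

lemma inner_gram:
  fixes A :: "real^'n^'m"
  shows "x \<bullet> ((transpose A ** Diag d ** A) *v y)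
    = (\<Sum>i\<in>UNIV. d $ i * (row i A \<bullet> x) * (row i A \<bullet> y))"
proof -
  have "x \<bullet> ((transpose A ** Diag d ** A) *v y) = (A *v x) \<bullet> (Diag d *v (A *v y))"
    by (metis dot_lmul_matrix inner_commute matrix_vector_mul_assoc transpose_matrix_vector
        transpose_transpose)
  also have "\<dots> = (\<Sum>i\<in>UNIV. d $ i * (row i A \<bullet> x) * (row i A \<bullet> y))"
    by (simp add: inner_vec_def matrix_vector_mult_def Diag_def row_def if_distrib if_distribR
        mult_ac cong: if_cong)
  finally show ?thesis .
qed

text \<open>A kernel vector makes a positively weighted sum of squares vanish, hence is annihilated
  by \<open>A\<close>, and full column rank forces it to be zero.\<close>

lemma invertible_gram:
  fixes A :: "real^'n^'m"
  assumes "rank A = CARD('n)" and d: "\<And>i. d $ i > 0"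
  shows "invertible (transpose A ** Diag d ** A)"
  unfolding invertible_left_inverse matrix_left_invertible_ker
proof (intro allI impI)
  fix x assume "(transpose A ** Diag d ** A) *v x = 0"
  then have "(\<Sum>i\<in>UNIV. d $ i * (row i A \<bullet> x)\<^sup>2) = 0"
    using inner_gram[of x A d x] by (simp add: power2_eq_square mult.assoc)
  then have "\<forall>i. row i A \<bullet> x = 0"
    using d
    by (subst (asm) sum_nonneg_eq_0_iff) (auto simp: less_le)
  then have "A *v x = 0"
    by (simp add: matrix_mult_dot vec_eq_iff row_def)
  then show "x = 0"
    using assms(1) matrix_nonfull_linear_equations_eq by blast
qed

lemma symmetric_gram: "transpose (transpose A ** Diag d ** A) = transpose A ** Diag d ** (A::real^'n^'m)"
proof -
  have "transpose M $ k $ l = M $ l $ k" for M :: "real^'n^'n" and k l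
    by (simp add: transpose_def)
  then show ?thesis
    by (simp add: vec_eq_iff gram_nth mult_ac)
qed

lemma symmetric_matrix_inv:
  fixes M :: "real^'n^'n"
  assumes "invertible M" "transpose M = M"
  shows "transpose (matrix_inv M) = matrix_inv M"
  by (metis assms matrix_inv_left matrix_inv_right matrix_mul_assoc matrix_mul_lid matrix_mul_rid
      matrix_transpose_mul transpose_mat)

section \<open>Eigenvalues of a diagonally scaled symmetric matrix\<close>

text \<open>Both matrices have the same eigenvectors, and for \<gamma> nonzero the affine map on the
  eigenvalues is a bijection of the complex numbers.\<close>

lemma eigenvalues_scaleR_mat_1_diff:
  assumes "\<gamma> \<noteq> 0"
  shows "eigenvalues (\<gamma> *\<^sub>R (mat 1 - K)) = (\<lambda>c. of_real \<gamma> * (1 - c)) ` eigenvalues K"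
proof -
  have *: "(\<chi> i j. complex_of_real ((\<gamma> *\<^sub>R (mat 1 - K)) $ i $ j)) *v v
      = of_real \<gamma> *s (v - (\<chi> i j. complex_of_real (K $ i $ j)) *v v)" for v
  proof -
    have "complex_of_real (\<gamma> * ((if i = j then 1 else 0) - K $ i $ j)) * v $ j
        = of_real \<gamma> * ((if i = j then v $ j else 0) - of_real (K $ i $ j) * v $ j)" for i j
      by (simp add: algebra_simps)
    then have "(\<Sum>j\<in>UNIV. complex_of_real (\<gamma> * ((if i = j then 1 else 0) - K $ i $ j)) * v $ j)
        = of_real \<gamma> * (v $ i - (\<Sum>j\<in>UNIV. of_real (K $ i $ j) * v $ j))" for i
      by (simp only: sum_subtractf flip: sum_distrib_left) simp
    then show ?thesis
      by (simp add: vec_eq_iff matrix_vector_mult_def mat_def right_diff_distrib)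
  qed
  have "(of_real \<gamma> *s (v - u) = (of_real \<gamma> * (1 - c)) *s v) = (u = c *s v)"
    for u v :: "complex^'a" and c
    using assms by (auto simp: vec_eq_iff algebra_simps)
  then have mem: "of_real \<gamma> * (1 - c) \<in> eigenvalues (\<gamma> *\<^sub>R (mat 1 - K)) \<longleftrightarrow> c \<in> eigenvalues K" for c
    unfolding eigenvalues_def mem_Collect_eq * by simp
  have "c = of_real \<gamma> * (1 - (1 - c / of_real \<gamma>))" for c :: complex
    using assms by simp
  then show ?thesis
    using mem by (metis (no_types, lifting) image_iff set_eqI)
qed

text \<open>An eigenvector of \<open>K\<close> solves the generalized problem
  \<open>H v = c Diag(w) v\<close>. Pairing with the conjugate of \<open>v\<close> exhibits
  \<open>c\<close> as a Rayleigh quotient \<sigma> / \<rho>, which \<open>pos\<close> and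
  \<open>le\<close> confine to the unit interval.\<close>

lemma eigenvalues_scaled_symmetric:
  fixes H K :: "real^'m^'m"
  assumes w: "\<And>i. w $ i > 0" and sym: "transpose H = H"
    and K: "\<And>i j. w $ i * K $ i $ j = H $ i $ j"
    and pos: "\<And>x. x \<bullet> (H *v x) \<ge> 0"
    and le: "\<And>x. x \<bullet> (H *v x) \<le> (\<Sum>i\<in>UNIV. w $ i * (x $ i)\<^sup>2)"
  shows "eigenvalues K \<subseteq> complex_of_real ` {0..1}"
proof
  fix c assume "c \<in> eigenvalues K"
  then obtain v where v0: "v \<noteq> 0" and v: "(\<chi> i j. complex_of_real (K $ i $ j)) *v v = c *s v"
    by (auto simp: eigenvalues_def)
  \<comment> \<open>The bounds on \<open>H\<close> concern real vectors, so they are applied to the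
    real and imaginary parts separately.\<close>
  define a b where "a = (\<chi> i. Re (v $ i))" and "b = (\<chi> i. Im (v $ i))"
  define \<rho> where "\<rho> = (\<Sum>i\<in>UNIV. w $ i * (cmod (v $ i))\<^sup>2)"
  define \<sigma> where "\<sigma> = a \<bullet> (H *v a) + b \<bullet> (H *v b)"
  have eq: "(\<Sum>j\<in>UNIV. complex_of_real (H $ i $ j) * v $ j) = of_real (w $ i) * (c * v $ i)" for i
  proof -
    have "(\<Sum>j\<in>UNIV. complex_of_real (K $ i $ j) * v $ j) = c * v $ i"
      using v by (simp add: vec_eq_iff matrix_vector_mult_def)
    then show ?thesis
      by (simp add: sum_distrib_left K[symmetric] flip: mult.assoc)
        (simp add: mult.assoc flip: sum_distrib_left)
  qed
  have "of_real \<rho> * c = (\<Sum>i\<in>UNIV. cnj (v $ i) * (of_real (w $ i) * (c * v $ i)))"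
    by (simp add: \<rho>_def sum_distrib_right sum_distrib_left mult_ac complex_norm_square
        del: of_real_power)
  also have "\<dots> = (\<Sum>i\<in>UNIV. \<Sum>j\<in>UNIV. of_real (H $ i $ j) * (cnj (v $ i) * v $ j))"
    unfolding eq[symmetric] sum_distrib_left by (intro sum.cong refl) (simp only: mult_ac)
  also have "\<dots> = of_real \<sigma>"
  proof (rule complex_eqI)
    show "Re (\<Sum>i\<in>UNIV. \<Sum>j\<in>UNIV. of_real (H $ i $ j) * (cnj (v $ i) * v $ j)) = Re (of_real \<sigma>)"
      by (simp add: \<sigma>_def a_def b_def inner_vec_def matrix_vector_mult_def sum_distrib_left
          algebra_simps sum.distrib)
    \<comment> \<open>The imaginary part consists of the mixed terms
      \<open>Re (v $ i) * Im (v $ j) - Im (v $ i) * Re (v $ j)\<close> weighted by \<open>H\<close>;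
      symmetry cancels them.\<close>
    have "H $ j $ i = H $ i $ j" for i j
      using sym by (rule symmetric_nth)
    then have "(\<Sum>i\<in>UNIV. \<Sum>j\<in>UNIV. H $ i $ j * (Im (v $ i) * Re (v $ j)))
        = (\<Sum>i\<in>UNIV. \<Sum>j\<in>UNIV. H $ i $ j * (Re (v $ i) * Im (v $ j)))"
      by (subst sum.swap) (simp add: mult_ac)
    then show "Im (\<Sum>i\<in>UNIV. \<Sum>j\<in>UNIV. of_real (H $ i $ j) * (cnj (v $ i) * v $ j)) = Im (of_real \<sigma>)"
      by (simp add: algebra_simps sum_subtractf sum.distrib)
  qed
  finally have c: "of_real \<rho> * c = of_real \<sigma>" .
  obtain k where "v $ k \<noteq> 0"
    using v0 by (auto simp: vec_eq_iff)
  then have \<rho>: "\<rho> > 0"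
    unfolding \<rho>_def using w by (intro sum_pos2[of UNIV k]) (auto simp: less_imp_le)
  have "\<sigma> \<le> \<rho>"
    using add_mono[OF le[of a] le[of b]]
    by (simp add: \<sigma>_def \<rho>_def a_def b_def cmod_power2 distrib_left sum.distrib)
  moreover have "\<sigma> \<ge> 0"
    using pos by (simp add: \<sigma>_def)
  moreover have "c = of_real (\<sigma> / \<rho>)"
    using c \<rho> by (simp add: field_simps)
  ultimately show "c \<in> complex_of_real ` {0..1}"
    using \<rho> by (intro image_eqI[of _ _ "\<sigma> / \<rho>"]) auto
qed

text \<open>Eigenvectors for different eigenvalues are orthogonal with respect to the weights.\<close>

lemma finite_eigenvalues_scaled_symmetric:
  fixes H K :: "real^'m^'m"
  assumes w: "\<And>i. w $ i > 0" and sym: "transpose H = H"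
    and K: "\<And>i j. w $ i * K $ i $ j = H $ i $ j"
  shows "finite {x. complex_of_real x \<in> eigenvalues K}"
proof -
  let ?E = "{x. complex_of_real x \<in> eigenvalues K}"
  have "\<exists>u. u \<noteq> 0 \<and> K *v u = x *\<^sub>R u" if x: "x \<in> ?E" for x
  proof -
    obtain v where v0: "v \<noteq> 0"
      and v: "(\<chi> i j. complex_of_real (K $ i $ j)) *v v = of_real x *s v"
      using x unfolding eigenvalues_def by auto
    have eq: "(\<Sum>j\<in>UNIV. complex_of_real (K $ i $ j) * v $ j) = of_real x * v $ i" for i
      using v by (simp add: vec_eq_iff matrix_vector_mult_def)
    \<comment> \<open>As \<open>K\<close> and \<open>x\<close> are real, real and imaginary part
      each satisfy the eigenvalue equation, and one of them is nonzero.\<close>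
    have "K *v (\<chi> i. Re (v $ i)) = x *\<^sub>R (\<chi> i. Re (v $ i))"
      using arg_cong[OF eq, of Re] by (simp add: vec_eq_iff matrix_vector_mult_def)
    moreover have "K *v (\<chi> i. Im (v $ i)) = x *\<^sub>R (\<chi> i. Im (v $ i))"
      using arg_cong[OF eq, of Im] by (simp add: vec_eq_iff matrix_vector_mult_def)
    moreover have "(\<chi> i. Re (v $ i)) \<noteq> 0 \<or> (\<chi> i. Im (v $ i)) \<noteq> 0"
      using v0 by (auto simp: vec_eq_iff complex_eq_iff)
    ultimately show ?thesis by blast
  qed
  then obtain u where u0: "\<And>x. x \<in> ?E \<Longrightarrow> u x \<noteq> 0"
    and u: "\<And>x. x \<in> ?E \<Longrightarrow> K *v u x = x *\<^sub>R u x"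
    by metis
  \<comment> \<open>Scaling by square roots turns the weighted inner product into the standard one,
    so the finiteness of orthogonal families applies.\<close>
  define g where "g = (\<lambda>x. \<chi> i. sqrt (w $ i) * u x $ i)"
  have g0: "g x \<noteq> 0" if "x \<in> ?E" for x
    using u0[OF that] w by (auto simp: g_def vec_eq_iff) (metis less_irrefl)
  have inner_g: "x * (g y \<bullet> g x) = u y \<bullet> (H *v u x)" if "x \<in> ?E" for x y
  proof -
    have "(H *v u x) $ i = w $ i * (x * u x $ i)" for i
    proof -
      have "(H *v u x) $ i = w $ i * (K *v u x) $ i"
        by (simp add: matrix_vector_mult_def K[symmetric] sum_distrib_left mult.assoc)
      then show ?thesis
        by (simp add: u[OF that])
    qed
    moreover have "x * (sqrt (w $ i) * a * (sqrt (w $ i) * b)) = a * (w $ i * (x * b))" for i a b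
      using w[of i] by (simp add: mult_ac less_imp_le)
    ultimately show ?thesis
      unfolding g_def inner_vec_def sum_distrib_left by (intro sum.cong refl) simp
  qed
  have orth: "g x \<bullet> g y = 0" if "x \<in> ?E" "y \<in> ?E" "x \<noteq> y" for x y
  proof -
    have "x * (g y \<bullet> g x) = u x \<bullet> (H *v u y)"
      unfolding inner_g[OF that(1)]
      by (metis sym dot_lmul_matrix inner_commute transpose_matrix_vector)
    also have "\<dots> = y * (g x \<bullet> g y)"
      using inner_g[OF that(2)] by simp
    finally show ?thesis
      using that(3) by (simp add: inner_commute)
  qed
  have "inj_on g ?E"
    by (rule inj_onI) (metis g0 inner_eq_zero_iff orth)
  moreover have "finite (g ` ?E)"
    by (rule pairwise_orthogonal_imp_finite) (auto simp: pairwise_def orthogonal_def intro: orth)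
  ultimately show ?thesis
    by (rule finite_imageD[rotated])
qed

section \<open>The Hadamard square of an orthogonal projection\<close>

text \<open>An instance of the Schur product theorem. Expanding each factor by
  \<open>P = P P^T\<close> turns the form into the sum over \<open>k\<close>, \<open>l\<close> of
  the squares of \<open>\<Sum>i. x $ i * P $ i $ k * P $ i $ l\<close>.\<close>

lemma inner_hadamard_square_nonneg:
  fixes P :: "real^'m^'m"
  assumes "transpose P = P" "P ** P = P"
  shows "x \<bullet> (hadamard P P *v x) \<ge> 0"
proof -
  have sym: "P $ j $ i = P $ i $ j" for i j
    using assms(1) by (rule symmetric_nth)
  have idem: "P $ i $ j = (\<Sum>k\<in>UNIV. P $ i $ k * P $ j $ k)" for i j
    using arg_cong[OF assms(2), of "\<lambda>Q. Q $ i $ j"] sym by (simp add: matrix_matrix_mult_def)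
  have "x \<bullet> (hadamard P P *v x)
      = (\<Sum>i\<in>UNIV. \<Sum>j\<in>UNIV. x $ i * x $ j * (P $ i $ j * P $ i $ j))"
    by (simp add: inner_vec_def matrix_vector_mult_def hadamard_def sum_distrib_left mult_ac)
  also have "\<dots> = (\<Sum>i\<in>UNIV. \<Sum>j\<in>UNIV. \<Sum>k\<in>UNIV. \<Sum>l\<in>UNIV.
      (x $ i * P $ i $ k * P $ i $ l) * (x $ j * P $ j $ k * P $ j $ l))"
    by (subst idem, subst idem) (simp add: sum_product sum_distrib_left mult_ac)
  also have "\<dots> = (\<Sum>k\<in>UNIV. \<Sum>l\<in>UNIV. \<Sum>i\<in>UNIV. \<Sum>j\<in>UNIV.
      (x $ i * P $ i $ k * P $ i $ l) * (x $ j * P $ j $ k * P $ j $ l))"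
    (is "(\<Sum>i\<in>UNIV. \<Sum>j\<in>UNIV. \<Sum>k\<in>UNIV. \<Sum>l\<in>UNIV. ?f i j k l) = _")
  proof -
    \<comment> \<open>Summing over pairs of indices makes the fourfold interchange a single
      swap.\<close>
    have "(\<Sum>i\<in>UNIV. \<Sum>j\<in>UNIV. \<Sum>k\<in>UNIV. \<Sum>l\<in>UNIV. ?f i j k l)
      = (\<Sum>q\<in>UNIV \<times> UNIV. \<Sum>r\<in>UNIV \<times> UNIV. ?f (fst q) (snd q) (fst r) (snd r))"
      by (simp add: sum.cartesian_product' del: UNIV_Times_UNIV)
    also have "\<dots> = (\<Sum>r\<in>UNIV \<times> UNIV. \<Sum>q\<in>UNIV \<times> UNIV. ?f (fst q) (snd q) (fst r) (snd r))"
      by (rule sum.swap)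
    finally show ?thesis
      by (simp add: sum.cartesian_product' del: UNIV_Times_UNIV)
  qed
  also have "\<dots> = (\<Sum>k\<in>UNIV. \<Sum>l\<in>UNIV. (\<Sum>i\<in>UNIV. x $ i * P $ i $ k * P $ i $ l)\<^sup>2)"
    by (simp add: power2_eq_square sum_product)
  finally show ?thesis
    by (simp add: sum_nonneg)
qed

text \<open>This is a diagonal entry of \<open>P P^T = P\<close>. It serves both the upper bound on
  the quadratic form and the row sums of \<open>K\<close>.\<close>

lemma sum_hadamard_square:
  fixes P :: "real^'m^'m"
  assumes "transpose P = P" "P ** P = P"
  shows "(\<Sum>j\<in>UNIV. (P $ i $ j)\<^sup>2) = P $ i $ i"
proof -
  have sym: "P $ j $ i = P $ i $ j" for i j
    using assms(1) by (rule symmetric_nth)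
  show ?thesis
    using arg_cong[OF assms(2), of "\<lambda>Q. Q $ i $ i"] sym
    by (simp add: matrix_matrix_mult_def power2_eq_square)
qed

text \<open>Bound \<open>2 * x $ i * x $ j\<close> by the sum of the two squares. By symmetry of
  \<open>P\<close>, both resulting double sums equal \<open>S\<close>.\<close>

lemma inner_hadamard_square_le:
  fixes P :: "real^'m^'m"
  assumes "transpose P = P" "P ** P = P"
  shows "x \<bullet> (hadamard P P *v x) \<le> (\<Sum>i\<in>UNIV. P $ i $ i * (x $ i)\<^sup>2)"
proof -
  have sym: "P $ j $ i = P $ i $ j" for i j
    using assms(1) by (rule symmetric_nth)
  define S where "S = (\<Sum>i\<in>UNIV. \<Sum>j\<in>UNIV. (P $ i $ j)\<^sup>2 * (x $ i)\<^sup>2)"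
  have S: "S = (\<Sum>i\<in>UNIV. P $ i $ i * (x $ i)\<^sup>2)"
    unfolding S_def by (simp add: sum_hadamard_square[OF assms] flip: sum_distrib_right)
  have S': "S = (\<Sum>i\<in>UNIV. \<Sum>j\<in>UNIV. (P $ i $ j)\<^sup>2 * (x $ j)\<^sup>2)"
    unfolding S_def by (subst sum.swap) (simp add: sym)
  have "2 * (x \<bullet> (hadamard P P *v x))
      = (\<Sum>i\<in>UNIV. \<Sum>j\<in>UNIV. (P $ i $ j)\<^sup>2 * (2 * x $ i * x $ j))"
    by (simp add: inner_vec_def matrix_vector_mult_def hadamard_def sum_distrib_left mult_ac
        power2_eq_square)
  also have "\<dots> \<le> (\<Sum>i\<in>UNIV. \<Sum>j\<in>UNIV. (P $ i $ j)\<^sup>2 * ((x $ i)\<^sup>2 + (x $ j)\<^sup>2))"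
    by (intro sum_mono mult_left_mono sum_squares_bound) auto
  also have "\<dots> = S + S"
    by (subst (2) S') (simp add: S_def distrib_left sum.distrib)
  finally show ?thesis
    by (simp add: S)
qed

section \<open>Derivative of the leverage scores\<close>

lemma Diag_powr_vec_exp: "Diag_powr (vec_exp x) a = Diag (\<chi> i. exp (a * x $ i))"
  by (simp add: Diag_powr_def vec_exp_def powr_def vec_eq_iff)

text \<open>Separates an exponential prefactor from the inverse Gram matrix, so that the product
  rule applies.\<close>

lemma leverage_scores_exp:
  "leverage_scores (Diag_powr (vec_exp x) (\<gamma> / 2) ** A) $ i
    = exp (\<gamma> * x $ i)
      * (row i A \<bullet> (matrix_inv (transpose A ** Diag (\<chi> i. exp (\<gamma> * x $ i)) ** A) *v row i A))"
proof -
  have "exp (\<gamma> / 2 * t) * exp (\<gamma> / 2 * t) = exp (\<gamma> * t)" for t :: real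
    by (simp flip: exp_add)
  then show ?thesis
    unfolding leverage_scores_def Diag_powr_vec_exp gram_Diag_mult row_Diag_mult
    by (simp add: matrix_vector_mult_scaleR row_Diag_mult flip: mult.assoc)
qed

lemma has_derivative_gram_exp:
  fixes A :: "real^'n^'m"
  shows "((\<lambda>x. transpose A ** Diag (\<chi> i. exp (\<gamma> * x $ i)) ** A) has_derivative
    (\<lambda>h. transpose A ** Diag (\<chi> i. exp (\<gamma> * x $ i) * (\<gamma> * h $ i)) ** A)) (at x)"
proof -
  have "linear (\<lambda>d. transpose A ** Diag d ** A)"
    by (rule linearI) (simp_all add: vec_eq_iff gram_nth algebra_simps sum.distrib sum_distrib_left)
  then have "bounded_linear (\<lambda>d. transpose A ** Diag d ** A)"
    by (simp add: linear_conv_bounded_linear)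
  moreover have "((\<lambda>x. \<chi> i. exp (\<gamma> * x $ i)) has_derivative
      (\<lambda>h. \<chi> i. exp (\<gamma> * x $ i) * (\<gamma> * h $ i))) (at x)"
    by (rule has_derivative_vec_lambda)
      (auto intro!: derivative_eq_intros bounded_linear_imp_has_derivative bounded_linear_vec_nth)
  ultimately show ?thesis
    by (rule bounded_linear.has_derivative)
qed

text \<open>The first term comes from the prefactor, the second from the inverse. The formula holds
  at every \<open>x\<close>; the fixed-point equation enters only later.\<close>

lemma has_derivative_leverage_scores_exp:
  fixes A :: "real^'n^'m" and \<gamma> :: real
  assumes "rank A = CARD('n)"
  defines "N \<equiv> \<lambda>x. matrix_inv (transpose A ** Diag (\<chi> i. exp (\<gamma> * x $ i)) ** A)"
  shows "((\<lambda>x. leverage_scores (Diag_powr (vec_exp x) (\<gamma> / 2) ** A) $ i) has_derivative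
    (\<lambda>h. \<gamma> * (h $ i * exp (\<gamma> * x $ i) * (row i A \<bullet> (N x *v row i A))
      - exp (\<gamma> * x $ i) * (\<Sum>j\<in>UNIV. exp (\<gamma> * x $ j) * (row i A \<bullet> (N x *v row j A))\<^sup>2 * h $ j)))) (at x)"
proof -
  let ?M = "\<lambda>x. transpose A ** Diag (\<chi> i. exp (\<gamma> * x $ i)) ** A"
  have inv: "invertible (?M x)" for x
    by (rule invertible_gram[OF assms(1)]) simp
  have sym: "transpose (N x) = N x"
    unfolding N_def by (rule symmetric_matrix_inv[OF inv symmetric_gram])
  have N_inner: "a \<bullet> (N x *v b) = (N x *v a) \<bullet> b" for a b
    by (metis sym dot_lmul_matrix transpose_matrix_vector)
  \<comment> \<open>Symmetry of \<open>N x\<close> shifts one inverse to the left, leaving the form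
    of \<open>inner_gram\<close>. The free \<open>d\<close> will be the derivative of the
    weights.\<close>
  have *: "row i A \<bullet> (N x *v ((transpose A ** Diag d ** A) *v (N x *v row i A)))
      = (\<Sum>j\<in>UNIV. d $ j * (row i A \<bullet> (N x *v row j A))\<^sup>2)" for d
    unfolding N_inner[of "row i A"] inner_gram
    by (simp add: inner_commute power2_eq_square mult_ac)
  have fold_N: "matrix_inv (?M z) = N z" for z
    by (simp add: N_def)
  have "((\<lambda>x. exp (\<gamma> * x $ i) * (row i A \<bullet> (N x *v row i A))) has_derivative
     (\<lambda>h. exp (\<gamma> * x $ i) * (row i A \<bullet>
          (- (N x *v ((transpose A ** Diag (\<chi> i. exp (\<gamma> * x $ i) * (\<gamma> * h $ i)) ** A) *v (N x *v row i A)))))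
        + exp (\<gamma> * x $ i) * (\<gamma> * h $ i) * (row i A \<bullet> (N x *v row i A)))) (at x)"
    unfolding N_def
    by (intro has_derivative_mult has_derivative_inner_right
        has_derivative_matrix_inv_mult[OF has_derivative_gram_exp inv])
      (auto intro!: derivative_eq_intros bounded_linear_imp_has_derivative bounded_linear_vec_nth)
  then show ?thesis
    unfolding leverage_scores_exp inner_minus_right * fold_N
    by (rule has_derivative_eq_rhs) (simp add: fun_eq_iff sum_distrib_left algebra_simps)
qed

section \<open>Specialization to the Lewis weights: Jacobian, eigenvalue bounds and spectral
  radius\<close>

theorem lemma3p1:
  fixes A :: "real^'n^'m" and p \<gamma> :: real and w :: "real^'m"
    and T :: "real^'m \<Rightarrow> real^'m" and P K J :: "real^'m^'m"
  assumes full_column_rank: "rank A = CARD('n)"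
    and no_zero_rows: "\<forall>i. row i A \<noteq> 0"
    and p: "p > 2"
    and \<gamma>: "\<gamma> = 1 - 2 / p"
    and lewis: "is_lewis_weights p A w"
    and T: "T = (\<lambda>u. leverage_scores (Diag_powr u (\<gamma> / 2) ** A))"
    and P: "P = Diag_powr w (\<gamma> / 2) ** A
                  ** matrix_inv (transpose A ** Diag_powr w \<gamma> ** A)
                  ** transpose A ** Diag_powr w (\<gamma> / 2)"
    and K: "K = matrix_inv (Diag w) ** hadamard P P"
    and J: "J = jacobian (\<lambda>x. vec_ln (T (vec_exp x))) (at (vec_ln w))"
  shows "(\<lambda>x. vec_ln (T (vec_exp x))) differentiable (at (vec_ln w))
         \<and> J = \<gamma> *\<^sub>R (mat 1 - K)
         \<and> eigenvalues K \<subseteq> complex_of_real ` {0..1}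
         \<and> spectral_radius J = (1 - 2 / p) * (1 - lambda_min K)"
proof -
  have \<gamma>0: "\<gamma> > 0"
    using p by (simp add: \<gamma>)
  have \<gamma>2: "1 / 2 - 1 / p = \<gamma> / 2"
    by (simp add: \<gamma> field_simps)
  have w: "w $ i > 0" for i
    using lewis unfolding is_lewis_weights_def by blast
  define x where "x = vec_ln w"
  have wx: "w = vec_exp x"
    using w by (simp add: x_def vec_exp_def vec_ln_def vec_eq_iff)
  \<comment> \<open>In logarithmic coordinates this is the power
    \<open>w $ i powr \<gamma>\<close>.\<close>
  define e where "e = (\<lambda>i. exp (\<gamma> * x $ i))"
  define M where "M = transpose A ** Diag (\<chi> i. e i) ** A"
  define N where "N = matrix_inv M"
  have inv: "invertible M"
    unfolding M_def by (rule invertible_gram[OF full_column_rank]) (simp add: e_def)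
  have symN: "transpose N = N"
    unfolding N_def by (rule symmetric_matrix_inv[OF inv]) (simp add: M_def symmetric_gram)
  \<comment> \<open>With \<open>B^T B = M\<close>, the matrix \<open>P\<close> becomes
    \<open>B M^{-1} B^T\<close>, the orthogonal projection onto the column space of
    \<open>B\<close>.\<close>
  define B where "B = Diag_powr w (\<gamma> / 2) ** A"
  have trB: "transpose B = transpose A ** Diag_powr w (\<gamma> / 2)"
    unfolding B_def Diag_powr_def matrix_transpose_mul
    by (rule arg_cong[of _ _ "\<lambda>X. transpose A ** X"]) (simp add: vec_eq_iff transpose_def Diag_def)
  have BB: "transpose B ** B = M"
    unfolding B_def M_def wx Diag_powr_vec_exp gram_Diag_mult
    by (simp add: e_def flip: exp_add)
  have PB: "P = B ** N ** transpose B"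
    unfolding P trB N_def M_def
    by (simp add: B_def wx Diag_powr_vec_exp e_def matrix_mul_assoc)
  have symP: "transpose P = P"
    by (simp add: PB matrix_transpose_mul symN matrix_mul_assoc)
  have "P ** P = B ** (N ** (transpose B ** B)) ** N ** transpose B"
    by (simp add: PB matrix_mul_assoc)
  then have idemP: "P ** P = P"
    using matrix_inv_left[OF inv] by (simp add: BB N_def PB)
  have P_nth: "P $ i $ j = row i B \<bullet> (N *v row j B)" for i j
    by (simp add: PB matrix_matrix_mult_def transpose_def inner_vec_def row_def
        matrix_vector_mult_def sum_distrib_left sum_distrib_right mult_ac)
      (rule sum.swap)
  \<comment> \<open>The diagonal of \<open>P\<close> consists of the leverage scores of
    \<open>B\<close>, so this is the Lewis weight equation.\<close>
  have diagP: "P $ i $ i = w $ i" for i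
    using lewis unfolding is_lewis_weights_def \<gamma>2 B_def[symmetric]
    by (simp add: leverage_scores_def P_nth BB N_def)
  have P_sq: "(P $ i $ j)\<^sup>2 = e i * e j * (row i A \<bullet> (N *v row j A))\<^sup>2" for i j
  proof -
    have "(exp (\<gamma> / 2 * t))\<^sup>2 = exp (\<gamma> * t)" for t
      by (simp add: power2_eq_square flip: exp_add)
    then show ?thesis
      unfolding P_nth B_def wx Diag_powr_vec_exp row_Diag_mult
      by (simp add: matrix_vector_mult_scaleR power_mult_distrib e_def)
  qed
  have Diag_inv: "matrix_inv (Diag w) = Diag (\<chi> i. inverse (w $ i))"
  proof -
    have "Diag (\<chi> i. inverse (w $ i)) ** Diag w = mat 1"
      using w by (auto simp: vec_eq_iff Diag_mult_nth) (auto simp: Diag_def mat_def less_imp_neq[symmetric])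
    then show ?thesis
      by (metis invertible_left_inverse matrix_inv_right matrix_mul_assoc matrix_mul_lid matrix_mul_rid)
  qed
  have K_nth: "K $ i $ j = (P $ i $ j)\<^sup>2 / w $ i" for i j
    unfolding K Diag_inv
    by (simp add: Diag_mult_nth hadamard_def power2_eq_square divide_inverse)
  \<comment> \<open>The fixed-point property replaces the leverage score in the derivative by
    \<open>w $ i\<close> and makes the argument of the logarithm positive.\<close>
  have Tx: "T (vec_exp x) $ i = w $ i" for i
    using lewis unfolding is_lewis_weights_def \<gamma>2 T wx by simp
  have dT: "((\<lambda>x. T (vec_exp x) $ i) has_derivative
      (\<lambda>h. \<gamma> * (h $ i * w $ i - (\<Sum>j\<in>UNIV. (P $ i $ j)\<^sup>2 * h $ j)))) (at x)" for i
  proof -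
    have "e i * (row i A \<bullet> (N *v row i A)) = w $ i"
      using Tx[of i] unfolding T leverage_scores_exp N_def M_def e_def .
    then show ?thesis
      using has_derivative_leverage_scores_exp[OF full_column_rank, of \<gamma> i x]
      unfolding T by (simp add: P_sq N_def M_def e_def sum_distrib_left mult.assoc)
  qed
  have "((\<lambda>x. ln (T (vec_exp x) $ i)) has_derivative
      (\<lambda>h. ((\<gamma> *\<^sub>R (mat 1 - K)) *v h) $ i)) (at x)" for i
  proof -
    \<comment> \<open>The chain rule for \<open>ln\<close> divides by \<open>w $ i\<close>, which
      produces the factor \<open>Diag(w)^{-1}\<close> in \<open>K\<close>.\<close>
    have "((\<gamma> *\<^sub>R (mat 1 - K)) *v h) $ i
        = \<gamma> * (h $ i * w $ i - (\<Sum>j\<in>UNIV. (P $ i $ j)\<^sup>2 * h $ j)) * inverse (w $ i)" for h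
    proof -
      have "(K *v h) $ i = (\<Sum>j\<in>UNIV. (P $ i $ j)\<^sup>2 * h $ j) / w $ i"
        by (simp add: matrix_vector_mult_def K_nth sum_divide_distrib)
      then show ?thesis
        using w[of i]
        by (simp add: matrix_vector_mult_diff_rdistrib field_simps flip: scaleR_matrix_vector_assoc)
    qed
    then show ?thesis
      using has_derivative_ln[OF _ dT[of i]] w[of i] Tx[of i] by simp
  qed
  then have dF: "((\<lambda>x. vec_ln (T (vec_exp x))) has_derivative
      (\<lambda>h. (\<gamma> *\<^sub>R (mat 1 - K)) *v h)) (at x)"
    using has_derivative_vec_lambda[of "\<lambda>i x. ln (T (vec_exp x) $ i)"
        "\<lambda>i h. ((\<gamma> *\<^sub>R (mat 1 - K)) *v h) $ i" x]
    by (simp add: vec_ln_def)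
  then have diff: "(\<lambda>x. vec_ln (T (vec_exp x))) differentiable (at x)"
    by (auto simp: differentiable_def)
  have JK: "J = \<gamma> *\<^sub>R (mat 1 - K)"
    unfolding J jacobian_def x_def[symmetric] frechet_derivative_at[OF dF, symmetric]
    by simp
  have wK: "w $ i * K $ i $ j = hadamard P P $ i $ j" for i j
    using w[of i] by (simp add: K_nth hadamard_def power2_eq_square)
  have symH: "transpose (hadamard P P) = hadamard P P"
    using symP by (simp add: vec_eq_iff transpose_def hadamard_def)
  \<comment> \<open>Here \<open>diagP\<close> identifies the weights \<open>P $ i $ i\<close> of the
    upper bound with \<open>w $ i\<close>.\<close>
  have sub: "eigenvalues K \<subseteq> complex_of_real ` {0..1}"
    using inner_hadamard_square_nonneg[OF symP idemP] inner_hadamard_square_le[OF symP idemP]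
    by (intro eigenvalues_scaled_symmetric[OF w symH wK]) (auto simp: diagP)
  \<comment> \<open>Finiteness and nonemptiness of \<open>E\<close> ensure that the
    \<open>Min\<close> and \<open>Max\<close> below are attained.\<close>
  define E where "E = {x. complex_of_real x \<in> eigenvalues K}"
  have fin: "finite E"
    unfolding E_def by (rule finite_eigenvalues_scaled_symmetric[OF w symH wK])
  txt \<open>The rows of \<open>K\<close> sum to one, so \<open>K\<close> does have an eigenvalue.\<close>
  have "(\<Sum>j\<in>UNIV. K $ i $ j) = 1" for i
    using w[of i] by (simp add: K_nth sum_hadamard_square[OF symP idemP] diagP flip: sum_divide_distrib)
  then have "(\<chi> i j. complex_of_real (K $ i $ j)) *v 1 = 1 *s 1"
    by (simp add: vec_eq_iff matrix_vector_mult_def flip: of_real_sum)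
  then have one: "1 \<in> E"
    unfolding E_def eigenvalues_def by (simp add: exI[of _ 1])
  have eig: "eigenvalues K = complex_of_real ` E"
    using sub by (auto simp: E_def)
  have "cmod ` eigenvalues J = (\<lambda>x. \<gamma> * (1 - x)) ` E"
  proof -
    \<comment> \<open>The upper bound on the eigenvalues of \<open>K\<close> makes those of
      \<open>J\<close> nonnegative, so the modulus disappears.\<close>
    have "cmod (of_real \<gamma> * (1 - of_real x)) = \<gamma> * (1 - x)" if "x \<in> E" for x
    proof -
      have "x \<le> 1"
        using sub that by (auto simp: E_def)
      moreover have "of_real \<gamma> * (1 - of_real x) = complex_of_real (\<gamma> * (1 - x))"
        by simp
      ultimately show ?thesis
        using \<gamma>0 by (simp only: norm_of_real) simp
    qed
    then show ?thesis
      unfolding JK eigenvalues_scaleR_mat_1_diff[OF \<gamma>0[THEN less_imp_neq, symmetric]]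
      unfolding eig image_image by (rule image_cong[OF refl])
  qed
  \<comment> \<open>The map is decreasing because \<gamma> is positive, so its maximum sits at the
    smallest eigenvalue.\<close>
  moreover have "Max ((\<lambda>x. \<gamma> * (1 - x)) ` E) = \<gamma> * (1 - Min E)"
    using fin one \<gamma>0 by (intro Max_eqI) (auto intro!: imageI Min_in)
  ultimately have "spectral_radius J = \<gamma> * (1 - lambda_min K)"
    by (simp add: spectral_radius_def lambda_min_def E_def)
  then show ?thesis
    using diff JK sub \<gamma> by (simp add: x_def)
qed

end
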